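(* Let $(\mathbb{Z},b,\mathcal{D})$ be a number system, where $b\ge 3$ and where $|d'|\le b$ for all $d'\in\mathcal{D}$. Fix some $d\in\mathcal{D}$ and some integer $u$ with $|u|\le b-1$; if $0\notin\mathcal{D}$, assume moreover $|u|\le b-2$. Let $\mathcal{B}$ be the set of digits in $\mathcal{D}$ that occur in the (minimal-length) expansions in base $b$ with digits in $\mathcal{D}$ of the integers $0$, $u+1$, $u$, and $u-1$. If $d\notin\mathcal{B}$, then for every integer $k\ge 1$, putting $\tilde d=d-ub^k$ and $\tilde{\mathcal{D}}=(\mathcal{D}\setminus\{d\})\cup\{\tilde d\}$, the triple $(\mathbb{Z},b,\tilde{\mathcal{D}})$ is again a number system.
   Context: A pre-number system $(\mathbb{Z},b,\mathcal{D})$ consists of an integer $b$ (the base) with $|b|\ge 2$ and a finite set $\mathcal{D}\subset\mathbb{Z}$ (the digit set) covering all residue classes modulo $b$. Digit sets are assumed irredundant: $|\mathcal{D}|=|b|$, so $\mathcal{D}$ contains exactly one element of each residue class modulo $b$. The pre-number system is a number system if every $a\in\mathbb{Z}$ can be written as $a=\sum_{i=0}^{\ell-1}d_ib^i$ with $\ell\ge 1$ and all $d_i\in\mathcal{D}$. In a number system every integer $a$ (including $0$) has a unique such expansion of minimal length $\ell\ge 1$; "the expansion of $a$" means this one (for $a=0$ it is the digit sequence $(0)$ if $0\in\mathcal{D}$, and otherwise the shortest nonempty digit sequence with value $0$). *)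

theory Defs
  imports "HOL-Number_Theory.Cong"
begin

definition pre_number_system :: "int \<Rightarrow> int set \<Rightarrow> bool" where
  "pre_number_system b D \<longleftrightarrow>
     \<bar>b\<bar> \<ge> 2 \<and> finite D \<and> (\<forall>a. \<exists>d\<in>D. [a = d] (mod b)) \<and> int (card D) = \<bar>b\<bar>"

text \<open>Digit sequences are lists with the least significant digit first.\<close>

definition digits_value :: "int \<Rightarrow> int list \<Rightarrow> int" where
  "digits_value b ds = (\<Sum>i<length ds. ds ! i * b ^ i)"

definition represents :: "int \<Rightarrow> int set \<Rightarrow> int list \<Rightarrow> int \<Rightarrow> bool" where
  "represents b D ds a \<longleftrightarrow> ds \<noteq> [] \<and> set ds \<subseteq> D \<and> a = digits_value b ds"

definition number_system :: "int \<Rightarrow> int set \<Rightarrow> bool" where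
  "number_system b D \<longleftrightarrow> pre_number_system b D \<and> (\<forall>a. \<exists>ds. represents b D ds a)"

text \<open>The description below is proper in every number system; this is
  \<open>expansion_unique\<close> at the end of this theory.\<close>

definition expansion :: "int \<Rightarrow> int set \<Rightarrow> int \<Rightarrow> int list" where
  "expansion b D a =
     (THE ds. represents b D ds a \<and> (\<forall>es. represents b D es a \<longrightarrow> length ds \<le> length es))"

lemma digits_value_Cons: "digits_value b (d # ds) = d + b * digits_value b ds"
  unfolding digits_value_def length_Cons sum.lessThan_Suc_shift
  by (simp add: sum_distrib_left algebra_simps)

lemma pre_number_system_inj:
  assumes "pre_number_system b D" "x \<in> D" "y \<in> D" "[x = y] (mod b)"
  shows "x = y"
proof -
  from assms(1) have b: "\<bar>b\<bar> \<ge> 2" and fin: "finite D"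
    and cov: "\<And>a. \<exists>d\<in>D. [a = d] (mod b)" and crd: "int (card D) = \<bar>b\<bar>"
    by (auto simp: pre_number_system_def)
  have "{0..<\<bar>b\<bar>} \<subseteq> (\<lambda>d. d mod \<bar>b\<bar>) ` D"
  proof
    fix r assume r: "r \<in> {0..<\<bar>b\<bar>}"
    obtain d where d: "d \<in> D" "[r = d] (mod b)" using cov by blast
    then have "r mod \<bar>b\<bar> = d mod \<bar>b\<bar>" by (simp add: cong_iff_dvd_diff mod_eq_dvd_iff)
    with r d(1) show "r \<in> (\<lambda>d. d mod \<bar>b\<bar>) ` D" by force
  qed
  then have "card {0..<\<bar>b\<bar>} \<le> card ((\<lambda>d. d mod \<bar>b\<bar>) ` D)"
    using fin by (intro card_mono) auto
  moreover have "card {0..<\<bar>b\<bar>} = card D" using crd by simp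
  ultimately have "inj_on (\<lambda>d. d mod \<bar>b\<bar>) D"
    using fin card_image_le[OF fin, of "\<lambda>d. d mod \<bar>b\<bar>"] by (intro eq_card_imp_inj_on) auto
  moreover have "x mod \<bar>b\<bar> = y mod \<bar>b\<bar>"
    using assms(4) by (simp add: cong_iff_dvd_diff mod_eq_dvd_iff)
  ultimately show ?thesis using assms(2,3) by (auto dest: inj_onD)
qed

lemma digits_value_inj:
  assumes "pre_number_system b D"
  shows "length ds = length es \<Longrightarrow> set ds \<subseteq> D \<Longrightarrow> set es \<subseteq> D \<Longrightarrow>
    digits_value b ds = digits_value b es \<Longrightarrow> ds = es"
proof (induction ds es rule: list_induct2)
  case Nil
  show ?case by simp
next
  case (Cons x xs y ys)
  have eq: "x + b * digits_value b xs = y + b * digits_value b ys"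
    using Cons.prems(3) by (simp add: digits_value_Cons)
  then have "x - y = b * (digits_value b ys - digits_value b xs)"
    by (simp add: algebra_simps)
  then have "[x = y] (mod b)" by (simp add: cong_iff_dvd_diff)
  then have xy: "x = y" using pre_number_system_inj[OF assms] Cons.prems by auto
  have "b \<noteq> 0" using assms by (auto simp: pre_number_system_def)
  with eq xy have "digits_value b xs = digits_value b ys" by simp
  with Cons xy show ?case by auto
qed

lemma expansion_unique:
  assumes "number_system b D"
  shows "\<exists>!ds. represents b D ds a \<and> (\<forall>es. represents b D es a \<longrightarrow> length ds \<le> length es)"
proof (rule ex_ex1I)
  from assms have "\<exists>ds. represents b D ds a" by (auto simp: number_system_def)
  then show "\<exists>ds. represents b D ds a \<and> (\<forall>es. represents b D es a \<longrightarrow> length ds \<le> length es)"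
    using ex_has_least_nat[of "\<lambda>ds. represents b D ds a" _ length] by blast
next
  fix ds es
  assume A: "represents b D ds a \<and> (\<forall>es. represents b D es a \<longrightarrow> length ds \<le> length es)"
    and B: "represents b D es a \<and> (\<forall>ds. represents b D ds a \<longrightarrow> length es \<le> length ds)"
  then have "length ds = length es" by (simp add: antisym)
  then show "ds = es"
    using A B assms digits_value_inj[of b D ds es]
    by (auto simp: represents_def number_system_def)
qed

end

theory Submission
  imports Defs
begin

text \<open>
  Replacing the digit \<open>d\<close> by \<open>d - u * b ^ k\<close> at some position is compensated by adding \<open>u\<close>
  at the position \<open>k\<close> places higher. Digit extraction in the new system therefore runs on states
  \<open>e + u * (\<Sum>i<k. q\<^sub>i * b ^ i)\<close>, where \<open>q\<^sub>i \<in> {0, 1}\<close> is a queue of pending corrections and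
  the carry \<open>e\<close> evolves by extracting the old digit of \<open>e + u * q\<^sub>0\<close>. The size of the digits forces
  \<open>\<bar>e\<bar> \<le> 1\<close> eventually. From then on \<open>e\<close> either follows its old expansion down to \<open>0\<close> or meets a
  correction and becomes the tail of the expansion of one of \<open>u - 1\<close>, \<open>u\<close>, \<open>u + 1\<close>. Either way \<open>d\<close>
  never occurs again, the queue empties and the carry runs to \<open>0\<close>.
\<close>

section \<open>Values of digit strings, and replacing a digit\<close>

text \<open>The empty string is allowed, so that \<open>0\<close> ends every recursion even when
  \<open>0\<close> is not a digit.\<close>

definition spanned :: "int \<Rightarrow> int set \<Rightarrow> int set" where
  "spanned b D = digits_value b ` {ds. set ds \<subseteq> D}"

lemma digits_value_Nil [simp]: "digits_value b [] = 0"
  by (simp add: digits_value_def)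

lemma digits_value_snoc: "digits_value b (ds @ [x]) = digits_value b ds + x * b ^ length ds"
  by (induction ds) (simp_all add: digits_value_Cons algebra_simps)

lemma digits_value_replicate_0 [simp]: "digits_value b (replicate n 0) = 0"
  by (induction n) (simp_all add: digits_value_Cons)

lemma spanned_0: "0 \<in> spanned b D"
  unfolding spanned_def by (rule image_eqI[where x = "[]"]) auto

lemma spanned_step:
  assumes "c \<in> D" "a \<in> spanned b D"
  shows "c + b * a \<in> spanned b D"
proof -
  obtain ds where "set ds \<subseteq> D" "a = digits_value b ds"
    using assms(2) by (auto simp: spanned_def)
  then show ?thesis
    unfolding spanned_def using assms(1)
    by (intro image_eqI[where x = "c # ds"]) (auto simp: digits_value_Cons)
qed

lemma spanned_mono: "C \<subseteq> D \<Longrightarrow> spanned b C \<subseteq> spanned b D"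
  unfolding spanned_def by (intro image_mono) auto

lemma represents_cases:
  assumes "represents b D ds a"
  obtains c a' where "c \<in> D" "a' \<in> spanned b D" "a = c + b * a'"
  using assms by (cases ds) (auto simp: represents_def spanned_def digits_value_Cons)

lemma represents_mono: "represents b C ds a \<Longrightarrow> C \<subseteq> D \<Longrightarrow> represents b D ds a"
  by (auto simp: represents_def)

text \<open>Splitting off a digit fails only for the empty string, which \<open>zs\<close>
  replaces.\<close>

lemma spanned_cases:
  assumes "a \<in> spanned b D" "represents b D zs 0"
  obtains c a' where "c \<in> D" "a' \<in> spanned b D" "a = c + b * a'"
proof -
  obtain ds where ds: "set ds \<subseteq> D" "a = digits_value b ds"
    using assms(1) by (auto simp: spanned_def)
  then have "represents b D (if ds = [] then zs else ds) a"
    using assms(2) by (auto simp: represents_def)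
  then show ?thesis using that by (elim represents_cases)
qed

lemma number_system_expansion_represents:
  assumes "number_system b D"
  shows "represents b D (expansion b D a) a"
  using theI'[OF expansion_unique[OF assms, of a]] unfolding expansion_def by blast

text \<open>Since \<open>s = s * (1 - b) + b * s\<close>, digit extraction maps \<open>s\<close> to
  itself and never reaches \<open>0\<close> unless \<open>s = 0\<close>.\<close>

lemma number_system_fixed_point:
  assumes "number_system b D" "s * (1 - b) \<in> D"
  shows "s = 0"
proof (rule ccontr)
  assume "s \<noteq> 0"
  from assms(1) have pre: "pre_number_system b D" by (simp add: number_system_def)
  then have b: "b \<noteq> 0" by (auto simp: pre_number_system_def)
  have "digits_value b ds \<noteq> s" if "set ds \<subseteq> D" for ds
    using that
  proof (induction ds)
    case Nil
    then show ?case using \<open>s \<noteq> 0\<close> by simp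
  next
    case (Cons c ds)
    show ?case
    proof
      assume "digits_value b (c # ds) = s"
      then have eq: "c + b * digits_value b ds = s" by (simp add: digits_value_Cons)
      then have "c - s * (1 - b) = b * (s - digits_value b ds)" by (simp add: algebra_simps)
      then have "[c = s * (1 - b)] (mod b)" by (simp add: cong_iff_dvd_diff)
      then have "c = s * (1 - b)"
        using pre_number_system_inj[OF pre] Cons.prems assms(2) by auto
      with eq have "b * digits_value b ds = b * s" by (simp add: algebra_simps)
      then show False using b Cons by simp
    qed
  qed
  then show False
    using number_system_expansion_represents[OF assms(1), of s]
    unfolding represents_def by metis
qed

lemma pre_number_system_replace_digit:
  assumes "pre_number_system b D" "d \<in> D" "[d = d'] (mod b)"
  shows "pre_number_system b (insert d' (D - {d}))"
proof -
  from assms(1) have fin: "finite D" and b: "\<bar>b\<bar> \<ge> 2" "int (card D) = \<bar>b\<bar>"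
    and cov: "\<And>a. \<exists>c\<in>D. [a = c] (mod b)"
    by (auto simp: pre_number_system_def)
  have "d' \<notin> D - {d}"
    using pre_number_system_inj[OF assms(1,2) _ assms(3)] by auto
  then have "card (insert d' (D - {d})) = card D"
    using fin assms(2) by (metis card.remove card_insert_disjoint finite_Diff)
  moreover have "\<exists>c\<in>insert d' (D - {d}). [a = c] (mod b)" for a
    using cov[of a] assms(3) by (metis cong_trans Diff_iff insertCI singletonD)
  ultimately show ?thesis using fin b by (simp add: pre_number_system_def)
qed

section \<open>Setting, and digits of extreme size\<close>

locale digit_replacement =
  fixes b d u :: int and D :: "int set" and k :: nat
  assumes number_system: "number_system b D"
    and base_ge: "b \<ge> 3"
    and digit_bound: "c \<in> D \<Longrightarrow> \<bar>c\<bar> \<le> b"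
    and u_bound: "\<bar>u\<bar> \<le> b - 1"
    and u_bound': "0 \<notin> D \<Longrightarrow> \<bar>u\<bar> \<le> b - 2"
    and d_avoided: "a \<in> {0, u + 1, u, u - 1} \<Longrightarrow> d \<notin> set (expansion b D a)"
    and k_pos: "k \<ge> 1"
begin

abbreviation new_digits :: "int set" where
  "new_digits \<equiv> insert (d - u * b ^ k) (D - {d})"

lemma pre: "pre_number_system b D"
  using number_system by (simp add: number_system_def)

lemma digit_exists: obtains c a' where "c \<in> D" "a = c + b * a'"
  using represents_cases[OF number_system_expansion_represents[OF number_system]] by metis

lemma digit_unique:
  assumes "c \<in> D" "c' \<in> D" "c + b * x = c' + b * y"
  shows "c = c'"
proof -
  have "c - c' = b * (y - x)" using assms(3) by (simp add: algebra_simps)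
  then show ?thesis
    using pre_number_system_inj[OF pre assms(1,2)] by (simp add: cong_iff_dvd_diff)
qed

lemma avoiding_represents:
  assumes "a \<in> {0, u + 1, u, u - 1}"
  shows "represents b (D - {d}) (expansion b D a) a"
  using number_system_expansion_represents[OF number_system, of a] d_avoided[OF assms]
  by (auto simp: represents_def)

lemma avoiding_spanned: "a \<in> {0, u + 1, u, u - 1} \<Longrightarrow> a \<in> spanned b (D - {d})"
  using avoiding_represents[of a] by (auto simp: represents_def spanned_def)

lemma avoiding_step:
  assumes "a \<in> spanned b (D - {d})"
  obtains c a' where "c \<in> D" "c \<noteq> d" "a' \<in> spanned b (D - {d})" "a = c + b * a'"
proof (rule spanned_cases[OF assms avoiding_represents[of 0]])
  show "0 \<in> {0, u + 1, u, u - 1}" by simp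
  fix c a'
  assume "c \<in> D - {d}" "a' \<in> spanned b (D - {d})" "a = c + b * a'"
  then show thesis by (intro that) auto
qed

text \<open>A digit \<open>\<plusminus>b\<close> represents the residue class of \<open>0\<close>.
  So \<open>0\<close> is not a digit, and \<open>c\<close> is the lowest digit of the expansion of
  \<open>0\<close>, which avoids \<open>d\<close>.\<close>

lemma extreme_digit:
  assumes "c \<in> D" "\<bar>c\<bar> = b"
  shows "\<bar>u\<bar> \<le> b - 2" "c \<noteq> d"
proof -
  obtain s where s: "c = b * s" "s \<noteq> 0"
  proof (cases "c \<ge> 0")
    case True then show ?thesis using assms(2) by (intro that[of 1]) auto
  next
    case False then show ?thesis using assms(2) by (intro that[of "-1"]) auto
  qed
  have "0 \<notin> D"
    using digit_unique[of 0 c s 0] assms s base_ge by auto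
  then show "\<bar>u\<bar> \<le> b - 2" by (rule u_bound')
  obtain c' a' where "c' \<in> D" "c' \<noteq> d" "0 = c' + b * a'"
    using avoiding_step[OF spanned_0] by metis
  then show "c \<noteq> d"
    using digit_unique[of c c' "- s" a'] assms s by auto
qed

lemma digit_abs_ne:
  assumes "c \<in> D"
  shows "\<bar>c\<bar> \<noteq> b - 1"
proof
  assume "\<bar>c\<bar> = b - 1"
  then have "c = 1 * (1 - b) \<or> c = (-1) * (1 - b)" by auto
  then show False
    using number_system_fixed_point[OF number_system] assms
    by (metis one_neq_zero neg_equal_0_iff_equal)
qed

section \<open>Size of the carry\<close>

lemma carry_eq_bound:
  assumes "c \<in> D" "e + u * x = c + b * e'" "x \<in> {0, 1}"
  shows "b * \<bar>e'\<bar> \<le> \<bar>e\<bar> + \<bar>u\<bar> + \<bar>c\<bar>"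
proof -
  have "b * \<bar>e'\<bar> = \<bar>b * e'\<bar>" using base_ge by (simp add: abs_mult)
  also have "b * e' = e + u * x - c" using assms(2) by simp
  finally show ?thesis using assms(3) by auto
qed

text \<open>If \<open>\<bar>e'\<bar> \<ge> 2\<close>, then
  \<open>2 * b \<le> 1 + (b - 1) + b\<close> is tight, a case that \<open>extreme_digit\<close>
  excludes.\<close>

lemma carry_le_1:
  assumes "c \<in> D" "e + u * x = c + b * e'" "x \<in> {0, 1}" "\<bar>e\<bar> \<le> 1"
  shows "\<bar>e'\<bar> \<le> 1"
proof (rule ccontr)
  assume "\<not> \<bar>e'\<bar> \<le> 1"
  then have "b * \<bar>e'\<bar> \<ge> b * 2" using base_ge by (intro mult_left_mono) auto
  with carry_eq_bound[OF assms(1-3)] assms(4) u_bound digit_bound[OF assms(1)]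
  have "\<bar>c\<bar> = b" "\<bar>u\<bar> = b - 1" by auto
  with extreme_digit(1)[OF assms(1)] show False by auto
qed

text \<open>Staying at \<open>2\<close> needs \<open>\<bar>c\<bar> \<ge> b - 1\<close>; the value
  \<open>b - 1\<close> is excluded by the fixed point argument, and \<open>\<bar>c\<bar> = b\<close>
  forces \<open>c \<noteq> d\<close>.\<close>

lemma carry_2:
  assumes "c \<in> D" "e + u * x = c + b * e'" "x \<in> {0, 1}" "\<bar>e\<bar> = 2"
  shows "\<bar>e'\<bar> \<le> 1 \<or> \<bar>e'\<bar> = 2 \<and> c \<noteq> d \<and> x = 1"
proof (cases "\<bar>e'\<bar> \<le> 1")
  case False
  note cbd = digit_bound[OF assms(1)]
  have "\<bar>e'\<bar> \<le> 2"
  proof (rule ccontr)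
    assume "\<not> \<bar>e'\<bar> \<le> 2"
    then have "b * \<bar>e'\<bar> \<ge> b * 3" using base_ge by (intro mult_left_mono) auto
    with carry_eq_bound[OF assms(1-3)] assms(4) u_bound cbd base_ge show False by auto
  qed
  with False have e': "\<bar>e'\<bar> = 2" by auto
  with carry_eq_bound[OF assms(1-3)] assms(4) u_bound cbd digit_abs_ne[OF assms(1)]
  have "\<bar>c\<bar> = b" by auto
  moreover have "x = 1"
  proof (rule ccontr)
    assume "x \<noteq> 1"
    then have "b * e' = e - c" using assms(2,3) by auto
    then have "b * \<bar>e'\<bar> \<le> \<bar>e\<bar> + \<bar>c\<bar>" 
      using base_ge abs_mult[of b e'] by simp
    then show False using e' assms(4) cbd base_ge by auto
  qed
  ultimately show ?thesis using e' extreme_digit(2)[OF assms(1)] by auto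
qed simp

text \<open>Otherwise \<open>(b - 1) * 3 \<le> \<bar>u\<bar> + \<bar>c\<bar> \<le> 2 * b -
  1\<close>, which fails for \<open>b \<ge> 3\<close>.\<close>

lemma carry_decreases:
  assumes "c \<in> D" "e + u * x = c + b * e'" "x \<in> {0, 1}" "\<bar>e\<bar> \<ge> 3"
  shows "\<bar>e'\<bar> < \<bar>e\<bar>"
proof (rule ccontr)
  assume "\<not> \<bar>e'\<bar> < \<bar>e\<bar>"
  then have "b * \<bar>e\<bar> \<le> b * \<bar>e'\<bar>" using base_ge by (intro mult_left_mono) auto
  moreover have "(b - 1) * 3 \<le> (b - 1) * \<bar>e\<bar>"
    using base_ge assms(4) by (intro mult_left_mono) auto
  then have "b * 3 - 3 \<le> b * \<bar>e\<bar> - \<bar>e\<bar>" by (simp add: algebra_simps)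
  ultimately show False
    using carry_eq_bound[OF assms(1-3)] u_bound digit_bound[OF assms(1)] base_ge
    by linarith
qed

section \<open>Running the queue of corrections\<close>

lemma avoiding_subset: "spanned b (D - {d}) \<subseteq> spanned b new_digits"
  by (intro spanned_mono) auto

text \<open>One digit extraction in the new system: the front correction is consumed and a new one
  is queued exactly when the old digit is \<open>d\<close>.\<close>

lemma queue_step:
  assumes "c \<in> D" "e + u * x = c + b * e'" "length (x # q) = k"
    and "e' + u * digits_value b (q @ [if c = d then 1 else 0]) \<in> spanned b new_digits"
  shows "e + u * digits_value b (x # q) \<in> spanned b new_digits"
proof (cases "c = d")
  case True
  \<comment> \<open>\<open>q\<close> has length \<open>k - 1\<close>, so the appended entry gets
    weight \<open>b ^ k\<close> after the shift.\<close>
  have "b ^ k = b * b ^ length q" using assms(3) by auto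
  then have "e + u * digits_value b (x # q)
      = (d - u * b ^ k) + b * (e' + u * digits_value b (q @ [1]))"
    using assms(2) True by (simp add: digits_value_Cons digits_value_snoc algebra_simps)
  then show ?thesis using assms(4) True spanned_step[of "d - u * b ^ k" new_digits] by simp
next
  case False
  have "e + u * digits_value b (x # q) = c + b * (e' + u * digits_value b (q @ [0]))"
    using assms(2) by (simp add: digits_value_Cons digits_value_snoc algebra_simps)
  then show ?thesis using assms(1,4) False spanned_step[of c new_digits] by simp
qed

text \<open>Nothing is ever appended, since \<open>d\<close> does not occur: the queue just shrinks,
  and its length is arbitrary.\<close>

lemma avoiding_carry_spanned:
  assumes "e \<in> spanned b (D - {d})" "\<bar>e\<bar> \<le> 1" "set q \<subseteq> {0, 1}"
  shows "e + u * digits_value b q \<in> spanned b new_digits"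
  using assms
proof (induction q arbitrary: e)
  case Nil
  then show ?case using avoiding_subset by auto
next
  case (Cons x q)
  have x: "x \<in> {0, 1}" using Cons.prems by auto
  have "e \<in> {-1, 0, 1}" using Cons.prems(2) by auto
  then have "e + u * x \<in> spanned b (D - {d})"
    using x Cons.prems(1) avoiding_spanned[of "e + u"] by (auto simp: algebra_simps)
  then obtain c e' where c: "c \<in> D" "c \<noteq> d" "e' \<in> spanned b (D - {d})" "e + u * x = c + b * e'"
    by (rule avoiding_step)
  have "e' + u * digits_value b q \<in> spanned b new_digits"
    using Cons.IH[OF c(3) carry_le_1[OF c(1,4) x Cons.prems(2)]] Cons.prems by simp
  moreover have "e + u * digits_value b (x # q) = c + b * (e' + u * digits_value b q)"
    using c(4) by (simp add: digits_value_Cons algebra_simps)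
  ultimately show ?case using c spanned_step[of c new_digits] by simp
qed

lemma carry_1_spanned:
  assumes "\<bar>e\<bar> \<le> 1" "set q \<subseteq> {0, 1}" "length q = k"
  shows "e + u * digits_value b q \<in> spanned b new_digits"
proof -
  \<comment> \<open>The induction runs along an old digit string of the carry, which may contain
    \<open>d\<close>; it is followed until the string ends or a correction reaches the
    front.\<close>
  have "digits_value b ds + u * digits_value b q \<in> spanned b new_digits"
    if "set ds \<subseteq> D" "\<bar>digits_value b ds\<bar> \<le> 1" "set q \<subseteq> {0, 1}" "length q = k" for ds q
    using that
  proof (induction ds arbitrary: q)
    case Nil
    then show ?case using avoiding_carry_spanned[OF spanned_0] by simp
  next
    case (Cons c ds)
    let ?e = "digits_value b (c # ds)"
    obtain x r where q: "q = x # r" using Cons.prems(4) k_pos by (cases q) auto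
    show ?case
    proof (cases "x = 0")
      case True
      then have st: "?e + u * x = c + b * digits_value b ds" by (simp add: digits_value_Cons)
      have c: "c \<in> D" using Cons.prems by simp
      have "\<bar>digits_value b ds\<bar> \<le> 1"
        using carry_le_1[OF c st] True Cons.prems(2) by simp
      then show ?thesis
        using queue_step[OF c st, of r] Cons q by auto
    next
      case False
      then have x: "x = 1" using Cons.prems q by auto
      have "?e \<in> {-1, 0, 1}" using Cons.prems(2) by auto
      then have "?e + u * x \<in> spanned b (D - {d})"
        using avoiding_spanned[of "?e + u"] x by (auto simp: algebra_simps)
      then obtain c' e' where c': "c' \<in> D" "c' \<noteq> d" "e' \<in> spanned b (D - {d})"
          "?e + u * x = c' + b * e'"
        by (rule avoiding_step)
      have "\<bar>e'\<bar> \<le> 1" using carry_le_1[OF c'(1,4)] x Cons.prems(2) by simp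
      then show ?thesis
        using queue_step[OF c'(1,4), of r] avoiding_carry_spanned[OF c'(3), of "r @ [0]"]
          c'(2) Cons.prems q by auto
    qed
  qed
  then show ?thesis
    using number_system_expansion_represents[OF number_system, of e] assms
    unfolding represents_def by metis
qed

text \<open>A carry of absolute value \<open>2\<close> persists only by consuming a correction and extracting the digit
  \<open>\<plusminus>b \<noteq> d\<close>, which creates no new correction; so it cannot persist for more than \<open>k\<close> steps.\<close>

lemma carry_2_spanned:
  assumes "\<bar>e\<bar> = 2" "set q \<subseteq> {0, 1}" "length (q @ replicate m 0) = k"
  shows "e + u * digits_value b (q @ replicate m 0) \<in> spanned b new_digits"
  using assms
proof (induction q arbitrary: e m)
  case Nil
  then obtain n where m: "m = Suc n" using k_pos by (cases m) auto
  obtain c e' where c: "c \<in> D" "e = c + b * e'" by (rule digit_exists)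
  then have st: "e + u * 0 = c + b * e'" by simp
  \<comment> \<open>The front entry is \<open>0\<close>, and the carry can stay at \<open>2\<close>
    only when it is \<open>1\<close>.\<close>
  have "\<bar>e'\<bar> \<le> 1" using carry_2[OF c(1) st] Nil.prems by simp
  then have "e' + u * digits_value b (replicate n 0 @ [if c = d then 1 else 0])
      \<in> spanned b new_digits"
    using Nil.prems m by (intro carry_1_spanned) auto
  then show ?case
    using queue_step[OF c(1) st, of "replicate n 0"] Nil.prems m
    by (simp add: digits_value_Cons)
next
  case (Cons x q)
  have x: "x \<in> {0, 1}" using Cons.prems by auto
  obtain c e' where c: "c \<in> D" "e + u * x = c + b * e'" by (rule digit_exists)
  consider "\<bar>e'\<bar> \<le> 1" | "\<bar>e'\<bar> = 2" "c \<noteq> d" using carry_2[OF c x Cons.prems(1)] by blast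
  then have "e' + u * digits_value b ((q @ replicate m 0) @ [if c = d then 1 else 0])
      \<in> spanned b new_digits"
  proof cases
    case 1
    then show ?thesis using Cons.prems by (intro carry_1_spanned) auto
  next
    case 2
    \<comment> \<open>The appended \<open>0\<close> joins the zero tail, so the part
      \<open>q\<close> that may hold corrections gets shorter.\<close>
    then show ?thesis
      using Cons.IH[of e' "Suc m"] Cons.prems by (simp add: replicate_append_same)
  qed
  then show ?case
    using queue_step[OF c, of "q @ replicate m 0"] Cons.prems by simp
qed

text \<open>Descent on \<open>\<bar>e\<bar>\<close> down to the two small cases; the queue keeps
  length \<open>k\<close> throughout.\<close>

lemma state_spanned:
  assumes "set q \<subseteq> {0, 1}" "length q = k"
  shows "e + u * digits_value b q \<in> spanned b new_digits"
  using assms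
proof (induction "nat \<bar>e\<bar>" arbitrary: e q rule: less_induct)
  case less
  consider "\<bar>e\<bar> \<le> 1" | "\<bar>e\<bar> = 2" | "\<bar>e\<bar> \<ge> 3" by linarith
  then show ?case
  proof cases
    case 1
    then show ?thesis using carry_1_spanned less.prems by blast
  next
    case 2
    then show ?thesis using carry_2_spanned[of e q 0] less.prems by simp
  next
    case 3
    obtain x r where q: "q = x # r" using less.prems k_pos by (cases q) auto
    obtain c e' where c: "c \<in> D" "e + u * x = c + b * e'" by (rule digit_exists)
    have "\<bar>e'\<bar> < \<bar>e\<bar>" using carry_decreases[OF c] 3 less.prems q by auto
    then have "e' + u * digits_value b (r @ [if c = d then 1 else 0]) \<in> spanned b new_digits"
      using less.prems q by (intro less.hyps) auto
    then show ?thesis using queue_step[OF c, of r] less.prems q by simp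
  qed
qed

section \<open>Conclusion\<close>

lemma new_number_system:
  assumes "d \<in> D"
  shows "number_system b new_digits"
proof -
  have "b dvd d - (d - u * b ^ k)" using k_pos by (simp add: dvd_power)
  then have "pre_number_system b new_digits"
    using pre assms by (intro pre_number_system_replace_digit) (auto simp: cong_iff_dvd_diff)
  moreover have "\<exists>ds. represents b new_digits ds a" for a
  proof -
    \<comment> \<open>Every integer is a state with no pending corrections.\<close>
    have "a \<in> spanned b new_digits"
      using state_spanned[of "replicate k 0" a] by (auto simp: set_replicate_conv_if)
    then obtain ds where "set ds \<subseteq> new_digits" "a = digits_value b ds"
      by (auto simp: spanned_def)
    \<comment> \<open>This nonempty string stands in for the empty one when \<open>a = 0\<close>; it
      avoids \<open>d\<close>, so its digits remain available.\<close>
    moreover have "represents b new_digits (expansion b D 0) 0"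
      using avoiding_represents[of 0] by (rule represents_mono) auto
    ultimately show ?thesis
      by (cases "ds = []") (auto simp: represents_def)
  qed
  ultimately show ?thesis by (simp add: number_system_def)
qed

end

theorem theorem3p7:
  fixes b d u :: int and D B :: "int set"
  assumes "number_system b D"
    and "b \<ge> 3"
    and "\<forall>d'\<in>D. \<bar>d'\<bar> \<le> b"
    and "d \<in> D"
    and "\<bar>u\<bar> \<le> b - 1"
    and "0 \<notin> D \<longrightarrow> \<bar>u\<bar> \<le> b - 2"
    and "B = (\<Union>a\<in>{0, u + 1, u, u - 1}. set (expansion b D a))"
    and "d \<notin> B"
  shows "\<forall>k::nat. k \<ge> 1 \<longrightarrow> number_system b ((D - {d}) \<union> {d - u * b ^ k})"
proof (intro allI impI)
  fix k :: nat
  assume "k \<ge> 1"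
  then interpret digit_replacement b d u D k
    using assms by unfold_locales auto
  show "number_system b ((D - {d}) \<union> {d - u * b ^ k})"
    using new_number_system[OF assms(4)] by simp
qed

end
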